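(* Let $D$ be a sink-free digraph that contains no anti-claw (i.e. no induced subdigraph isomorphic to $\vec{K}_{3,1}$). Then $D$ has a quasi-kernel of size at most $|V(D)|/2$.
   Context: A quasi-kernel of a digraph $D$ is an independent set $Q\subseteq V(D)$ such that for every vertex $v\in V(D)\setminus Q$ there is a directed path with one or two arcs from $v$ to some vertex of $Q$. A sink is a vertex with no out-neighbour; $D$ is sink-free if it has no sink. $\vec{K}_{3,1}$ (the anti-claw) is the digraph on four vertices $a_1,a_2,a_3,c$ whose arcs are exactly $a_1c,a_2c,a_3c$. *)

theory Defs
  imports Complex_Main "Graph_Theory.Digraph_Isomorphism"
begin

definition independent_set :: "('a, 'b) pre_digraph \<Rightarrow> 'a set \<Rightarrow> bool" where
  "independent_set D Q \<longleftrightarrow> Q \<subseteq> verts D \<and> (\<forall>u\<in>Q. \<forall>v\<in>Q. \<not> u \<rightarrow>\<^bsub>D\<^esub> v)"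

text \<open>Paths are given by their lists of arcs, so \<open>length p\<close> is the number of arcs.\<close>

definition quasi_kernel :: "('a, 'b) pre_digraph \<Rightarrow> 'a set \<Rightarrow> bool" where
  "quasi_kernel D Q \<longleftrightarrow>
     independent_set D Q \<and>
     (\<forall>v\<in>verts D - Q. \<exists>u\<in>Q. \<exists>p. pre_digraph.apath D v p u \<and> length p \<in> {1, 2})"

definition sink :: "('a, 'b) pre_digraph \<Rightarrow> 'a \<Rightarrow> bool" where
  "sink D v \<longleftrightarrow> v \<in> verts D \<and> \<not> (\<exists>w. v \<rightarrow>\<^bsub>D\<^esub> w)"

definition sink_free :: "('a, 'b) pre_digraph \<Rightarrow> bool" where
  "sink_free D \<longleftrightarrow> \<not> (\<exists>v. sink D v)"

text \<open>The vertex \<open>0\<close> plays the role of \<open>c\<close>, and \<open>1\<close>, \<open>2\<close>, \<open>3\<close> those of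
  the \<open>a\<^sub>i\<close>.\<close>

definition anti_claw :: "(nat, nat \<times> nat) pre_digraph" where
  "anti_claw =
     \<lparr>verts = {0, 1, 2, 3}, arcs = {(1, 0), (2, 0), (3, 0)}, tail = fst, head = snd\<rparr>"

definition anti_claw_free :: "('a, 'b) pre_digraph \<Rightarrow> bool" where
  "anti_claw_free D \<longleftrightarrow> \<not> (\<exists>H. induced_subgraph H D \<and> digraph_iso H anti_claw)"

lemma digraph_anti_claw: "digraph anti_claw"
  by unfold_locales (auto simp: anti_claw_def arc_to_ends_def)

end

theory Submission
  imports Defs
begin

text \<open>
  Let \<open>Q\<close> be a quasi-kernel of minimum size, \<open>A\<close> the set of in-neighbours of \<open>Q\<close> and \<open>B\<close> the
  set of the remaining vertices. Call \<open>q \<in> Q\<close> good if some \<open>a \<in> A\<close> has \<open>q\<close> as its only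
  out-neighbour in \<open>Q\<close>. If \<open>q\<close> is not good, then \<open>Q - {q}\<close> still absorbs everything but \<open>q\<close>, so
  by minimality all out-neighbours of \<open>q\<close> lie in \<open>B\<close>; choose one of them, \<open>f q\<close>. Without
  anti-claws the fibres of \<open>f\<close> have at most two elements. If \<open>q \<noteq> q'\<close> and \<open>f q = f q' = y\<close>, then
  \<open>{y} \<union> (Q - {q, q'})\<close> is independent and smaller than \<open>Q\<close>, hence not a quasi-kernel, and this
  yields some \<open>a \<in> A\<close> whose out-neighbours in \<open>Q\<close> are exactly \<open>q\<close> and \<open>q'\<close>. Let \<open>M\<close> contain one
  element of each fibre of \<open>f\<close>. Then \<open>f\<close> embeds \<open>M\<close> into \<open>B\<close>, while each \<open>q \<in> Q - M\<close> is the only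
  out-neighbour in \<open>Q - M\<close> of some \<open>a \<in> A\<close>, so that \<open>Q - M\<close> embeds into \<open>A\<close>.
\<close>

section \<open>Quasi-kernels of a relation on a finite set\<close>

definition quasi_kernel_on :: "('a \<Rightarrow> 'a \<Rightarrow> bool) \<Rightarrow> 'a set \<Rightarrow> 'a set \<Rightarrow> bool" where
  "quasi_kernel_on E V Q \<longleftrightarrow>
     Q \<subseteq> V \<and> (\<forall>u\<in>Q. \<forall>v\<in>Q. \<not> E u v) \<and>
     (\<forall>v\<in>V - Q. \<exists>u\<in>Q. E v u \<or> (\<exists>w\<in>V. E v w \<and> E w u))"

text \<open>Chvatal-Lovasz theorem: delete a vertex \<open>v\<close> with its in-neighbours and take
  \<open>Q\<close> for the rest. If \<open>v\<close> has an out-neighbour in \<open>Q\<close>, the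
  in-neighbours of \<open>v\<close> reach \<open>Q\<close> through \<open>v\<close>. Otherwise
  \<open>insert v Q\<close> is independent, as \<open>Q\<close> contains no in-neighbour of
  \<open>v\<close>.\<close>

lemma quasi_kernel_on_exists:
  assumes "finite V" and irrefl: "\<And>v. \<not> E v v"
  shows "\<exists>Q. quasi_kernel_on E V Q"
  using \<open>finite V\<close>
proof (induction V rule: finite_psubset_induct)
  case (psubset V)
  show ?case
  proof (cases "V = {}")
    case True
    then show ?thesis by (auto simp: quasi_kernel_on_def)
  next
    case False
    then obtain v where v: "v \<in> V" by blast
    define W where "W = V - {v} - {u. E u v}"
    have "W \<subset> V" using v by (auto simp: W_def)
    then obtain Q where Q: "quasi_kernel_on E W Q" using psubset.IH by blast
    show ?thesis
    proof (cases "\<exists>q\<in>Q. E v q")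
      case True
      then have "quasi_kernel_on E V Q"
        using Q v unfolding quasi_kernel_on_def W_def by blast
      then show ?thesis ..
    next
      case False
      then have "quasi_kernel_on E V (insert v Q)"
        using Q v irrefl unfolding quasi_kernel_on_def W_def by blast
      then show ?thesis ..
    qed
  qed
qed

text \<open>Choosing such a private \<open>a\<close> for each \<open>x\<close> is injective, because
  \<open>a\<close> determines \<open>x\<close>.\<close>

lemma card_le_if_private:
  assumes "finite A" and "\<And>x. x \<in> X \<Longrightarrow> \<exists>a\<in>A. {y \<in> X. E a y} = {x}"
  shows "card X \<le> card A"
proof -
  obtain g where g: "\<And>x. x \<in> X \<Longrightarrow> g x \<in> A \<and> {y \<in> X. E (g x) y} = {x}"
    using assms(2) by metis
  have "inj_on g X"
    by (rule inj_onI) (metis g singleton_inject)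
  then show ?thesis
    using g \<open>finite A\<close> by (metis card_inj_on_le image_subsetI)
qed

text \<open>The clause \<open>\<not> E c a\<close> in \<open>no_claw\<close> reflects that only
  induced anti-claws are excluded.\<close>

lemma small_quasi_kernel_on:
  assumes fin: "finite V" and irrefl: "\<And>v. \<not> E v v"
    and dom: "\<And>u v. E u v \<Longrightarrow> u \<in> V \<and> v \<in> V"
    and out: "\<And>v. v \<in> V \<Longrightarrow> \<exists>w. E v w"
    and no_claw: "\<And>c X. \<lbrakk>finite X; card X = 3; \<And>a. a \<in> X \<Longrightarrow> E a c \<and> \<not> E c a;
                         \<And>a b. \<lbrakk>a \<in> X; b \<in> X\<rbrakk> \<Longrightarrow> \<not> E a b\<rbrakk> \<Longrightarrow> False"
  shows "\<exists>Q. quasi_kernel_on E V Q \<and> 2 * card Q \<le> card V"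
proof -
  obtain Q where Q: "quasi_kernel_on E V Q"
    and min: "\<And>R. quasi_kernel_on E V R \<Longrightarrow> card Q \<le> card R"
    using ex_has_least_nat[of "quasi_kernel_on E V" _ card]
      quasi_kernel_on_exists[of V E, OF fin irrefl] by metis
  have QV: "Q \<subseteq> V" and indep: "\<And>u v. \<lbrakk>u \<in> Q; v \<in> Q\<rbrakk> \<Longrightarrow> \<not> E u v"
    and absorb: "\<And>v. v \<in> V - Q \<Longrightarrow> \<exists>u\<in>Q. E v u \<or> (\<exists>w. E v w \<and> E w u)"
    using Q unfolding quasi_kernel_on_def by blast+
  have finQ: "finite Q" using QV fin finite_subset by blast
  define A where "A = {a. \<exists>q\<in>Q. E a q}"
  define B where "B = V - Q - A"
  define good where "good q \<longleftrightarrow> (\<exists>a\<in>A. {x \<in> Q. E a x} = {q})" for q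
  have AV: "A \<subseteq> V" and AQ: "A \<inter> Q = {}"
    using dom indep by (auto simp: A_def)
  have finA: "finite A" and finB: "finite B"
    using AV fin by (auto simp: B_def intro: finite_subset)

  have bad_out: "w \<in> B" if q: "q \<in> Q" "\<not> good q" and w: "E q w" for q w
  proof (rule ccontr)
    assume "w \<notin> B"
    then have "w \<in> A" using w q dom indep by (auto simp: B_def)
    have other: "\<exists>x\<in>Q - {q}. E a x" if "a \<in> A" for a
      using that q unfolding good_def A_def by blast
    have "quasi_kernel_on E V (Q - {q})"
      unfolding quasi_kernel_on_def
    proof (intro conjI ballI)
      fix v assume v: "v \<in> V - (Q - {q})"
      \<comment> \<open>The vertex \<open>q\<close> itself is absorbed via \<open>w\<close>, which
        by \<open>other\<close> has an out-neighbour in \<open>Q - {q}\<close>.\<close>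
      consider "v = q" | "v \<in> A" | a where "a \<in> A" "E v a"
        using absorb[of v] v unfolding A_def by blast
      then show "\<exists>u\<in>Q - {q}. E v u \<or> (\<exists>w\<in>V. E v w \<and> E w u)"
        using other w \<open>w \<in> A\<close> AV by cases blast+
    qed (use QV indep in auto)
    from min[OF this] show False
      using q finQ by (metis card_Diff1_less not_le)
  qed

  define f where "f q = (SOME w. E q w)" for q
  have f: "E q (f q)" if "q \<in> Q" for q
    unfolding f_def using out QV that by (meson someI_ex subsetD)
  define N where "N = {q \<in> Q. \<not> good q}"
  have fB: "f ` N \<subseteq> B" using bad_out f by (auto simp: N_def)

  have pair: "\<exists>a\<in>A. {x \<in> Q. E a x} = {q, r}"
    if q: "q \<in> N" and r: "r \<in> N" and "q \<noteq> r" and eq: "f q = f r" for q r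
  proof -
    define y where "y = f q"
    have qQ: "q \<in> Q" and rQ: "r \<in> Q" using q r by (auto simp: N_def)
    have Eq: "E q y" and Er: "E r y" using f[OF qQ] f[OF rQ] eq by (simp_all add: y_def)
    have yB: "y \<in> B" using fB q by (auto simp: y_def)
    have y_out: "\<not> E y x" if "x \<in> Q" for x
      using yB that by (auto simp: B_def A_def)
    \<comment> \<open>A third in-neighbour in \<open>Q\<close> would complete an anti-claw at
      \<open>y\<close>, since \<open>y\<close> sends no arc to \<open>Q\<close>.\<close>
    have y_in: "x = q \<or> x = r" if "x \<in> Q" "E x y" for x
    proof (rule ccontr)
      assume "\<not> (x = q \<or> x = r)"
      then have "card {q, r, x} = 3" using \<open>q \<noteq> r\<close> by auto
      from no_claw[OF _ this, of y] show False
        using qQ rQ that indep y_out Eq Er by blast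
    qed
    define R where "R = insert y (Q - {q, r})"
    have "card R < card Q"
    proof -
      have "card R \<le> Suc (card (Q - {q, r}))" by (simp add: R_def card_insert_if finQ)
      moreover have "card (Q - {q, r}) = card Q - 2"
        using qQ rQ \<open>q \<noteq> r\<close> by (simp add: card_Diff_subset)
      moreover have "2 \<le> card Q"
        using card_mono[OF finQ, of "{q, r}"] qQ rQ \<open>q \<noteq> r\<close> by simp
      ultimately show ?thesis by linarith
    qed
    then have "\<not> quasi_kernel_on E V R" using min by (meson not_le)
    moreover have "R \<subseteq> V" using QV yB by (auto simp: R_def B_def)
    moreover have "\<not> E u v" if "u \<in> R" "v \<in> R" for u v
      using that indep y_out y_in irrefl by (auto simp: R_def)
    ultimately obtain v where v: "v \<in> V - R"
      and v_out: "\<And>u. u \<in> R \<Longrightarrow> \<not> E v u \<and> \<not> (\<exists>w. E v w \<and> E w u)"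
      unfolding quasi_kernel_on_def using dom by metis
    \<comment> \<open>An arc from \<open>v\<close> to \<open>q\<close> or \<open>r\<close> would
      continue to \<open>y\<close> in \<open>R\<close>; and \<open>v\<close> is not \<open>q\<close>
      or \<open>r\<close>, which send an arc to \<open>y\<close> directly.\<close>
    have vq: "\<not> E v q" "\<not> E v r" and vQ: "v \<notin> Q"
      using v v_out[of y] Eq Er by (auto simp: R_def)
    obtain x where "x \<in> Q" "E v x \<or> (\<exists>w. E v w \<and> E w x)"
      using absorb v vQ by blast
    then obtain w where w: "E v w" "E w x"
      using v_out[of x] vq by (auto simp: R_def)
    \<comment> \<open>The vertex \<open>w\<close> has no out-neighbour in \<open>R\<close>, which
      leaves only \<open>q\<close> and \<open>r\<close> within \<open>Q\<close>; a single one of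
      them would be good.\<close>
    have "w \<in> A" using w \<open>x \<in> Q\<close> by (auto simp: A_def)
    moreover have "{z \<in> Q. E w z} \<subseteq> {q, r}"
      using v_out w by (auto simp: R_def)
    moreover have "{z \<in> Q. E w z} \<noteq> {}" "{z \<in> Q. E w z} \<noteq> {q}" "{z \<in> Q. E w z} \<noteq> {r}"
      using \<open>x \<in> Q\<close> w \<open>w \<in> A\<close> q r by (auto simp: N_def good_def)
    ultimately show ?thesis by blast
  qed

  obtain M where M: "M \<subseteq> N" "inj_on f M" "f ` M = f ` N"
    by (metis subset_image_inj subset_refl)
  have MQ: "M \<subseteq> Q" using M by (auto simp: N_def)
  have "card M \<le> card B"
    using M fB finB by (metis card_inj_on_le)
  moreover have "card (Q - M) \<le> card A"
  proof (rule card_le_if_private[OF finA, where E = E])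
    fix x assume x: "x \<in> Q - M"
    show "\<exists>a\<in>A. {y \<in> Q - M. E a y} = {x}"
    proof (cases "good x")
      case True
      then show ?thesis using x unfolding good_def by blast
    next
      case False
      then have "x \<in> N" using x by (auto simp: N_def)
      then obtain r where "r \<in> M" "f x = f r" using M by (metis imageE imageI)
      moreover have "x \<noteq> r" using x \<open>r \<in> M\<close> by blast
      ultimately obtain a where "a \<in> A" "{y \<in> Q. E a y} = {x, r}"
        using pair[of x r] \<open>x \<in> N\<close> M by blast
      \<comment> \<open>Removing \<open>M\<close> takes away \<open>r\<close>, so \<open>x\<close>
        becomes private to \<open>a\<close>.\<close>
      then show ?thesis using x \<open>r \<in> M\<close> by blast
    qed
  qed
  moreover have "card Q = card M + card (Q - M)"
    using MQ finQ by (metis card_Diff_subset card_mono finite_subset le_add_diff_inverse)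
  moreover have "card V = card Q + card A + card B"
  proof -
    have "V = Q \<union> A \<union> B" using QV AV by (auto simp: B_def)
    moreover have "(Q \<union> A) \<inter> B = {}" by (auto simp: B_def)
    ultimately show ?thesis
      using finQ finA finB AQ by (simp add: card_Un_disjoint Int_commute)
  qed
  ultimately have "2 * card Q \<le> card V" by linarith
  then show ?thesis using Q by blast
qed

section \<open>Transfer to digraphs with arcs and paths\<close>

context digraph
begin

lemma not_dominates_self: "\<not> v \<rightarrow>\<^bsub>G\<^esub> v"
  using no_loops by (auto simp: arcs_ends_conv)

lemma quasi_kernel_if_on:
  assumes "quasi_kernel_on (\<lambda>u v. u \<rightarrow>\<^bsub>G\<^esub> v) (verts G) Q"
  shows "quasi_kernel G Q"
  unfolding quasi_kernel_def
proof (intro conjI ballI)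
  show "independent_set G Q"
    using assms by (simp add: quasi_kernel_on_def independent_set_def)
next
  fix v assume v: "v \<in> verts G - Q"
  then obtain u where u: "u \<in> Q"
    and "v \<rightarrow>\<^bsub>G\<^esub> u \<or> (\<exists>w. v \<rightarrow>\<^bsub>G\<^esub> w \<and> w \<rightarrow>\<^bsub>G\<^esub> u)"
    using assms unfolding quasi_kernel_on_def by blast
  then consider e where "e \<in> arcs G" "tail G e = v" "head G e = u"
    | e e' where "e \<in> arcs G" "tail G e = v" "e' \<in> arcs G" "head G e = tail G e'" "head G e' = u"
    by (auto simp: arcs_ends_conv)
  then show "\<exists>u\<in>Q. \<exists>p. apath v p u \<and> length p \<in> {1, 2}"
  proof cases
    case 1
    then have "apath v [e] u" using u v by (auto simp: apath_simps)
    then show ?thesis using u by (intro bexI[of _ u] exI[of _ "[e]"]) auto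
  next
    case 2
    \<comment> \<open>An \<open>apath\<close> repeats no vertex: \<open>v\<close> and
      \<open>u\<close> differ since only \<open>u\<close> is in \<open>Q\<close>, and loops are
      absent.\<close>
    then have "apath v [e, e'] u"
      using u v no_loops[of e] no_loops[of e'] by (auto simp: apath_simps)
    then show ?thesis using u by (intro bexI[of _ u] exI[of _ "[e, e']"]) auto
  qed
qed

lemma anti_claw_freeD:
  assumes free: "anti_claw_free G"
    and "card X = 3"
    and to_c: "\<And>a. a \<in> X \<Longrightarrow> a \<rightarrow>\<^bsub>G\<^esub> c \<and> \<not> c \<rightarrow>\<^bsub>G\<^esub> a"
    and indep: "\<And>a b. \<lbrakk>a \<in> X; b \<in> X\<rbrakk> \<Longrightarrow> \<not> a \<rightarrow>\<^bsub>G\<^esub> b"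
  shows False
proof -
  obtain x y z where X: "X = {x, y, z}" and dist: "x \<noteq> y" "y \<noteq> z" "x \<noteq> z"
    using \<open>card X = 3\<close> by (auto simp: card_3_iff)
  have c: "c \<noteq> x" "c \<noteq> y" "c \<noteq> z"
    using to_c X not_dominates_self by blast+
  define H where "H = G \<restriction> {c, x, y, z}"
  have "induced_subgraph H G"
    unfolding H_def
    using to_c[THEN conjunct1, THEN adj_in_verts(1)] to_c[THEN conjunct1, THEN adj_in_verts(2)] X
    by (intro induced_induce) blast
  define \<phi> :: "'a \<Rightarrow> nat" where
    "\<phi> v = (if v = c then 0 else if v = x then 1 else if v = y then 2 else 3)" for v
  \<comment> \<open>Arcs of \<open>anti_claw\<close> are pairs of end vertices, so each arc is sent
    to the labels of its ends.\<close>
  define F where "F = \<lparr>iso_verts = \<phi>, iso_arcs = (\<lambda>e. (\<phi> (tail G e), \<phi> (head G e))),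
    iso_head = snd, iso_tail = fst\<rparr>"
  have inj: "inj_on \<phi> {c, x, y, z}"
    using dist c by (auto simp: \<phi>_def inj_on_def)
  have wfH: "wf_digraph H"
    using \<open>induced_subgraph H G\<close> by (auto simp: induced_subgraph_def subgraph_def)
  have "inj_on (iso_arcs F) (arcs H)"
  proof (rule inj_onI)
    fix d e assume "d \<in> arcs H" "e \<in> arcs H" "iso_arcs F d = iso_arcs F e"
    then have in_G: "d \<in> arcs G" "e \<in> arcs G"
      and ends_in: "{tail G d, head G d, tail G e, head G e} \<subseteq> {c, x, y, z}"
      and eq: "\<phi> (tail G d) = \<phi> (tail G e)" "\<phi> (head G d) = \<phi> (head G e)"
      unfolding H_def F_def by simp_all
    have "arc_to_ends G d = arc_to_ends G e"
      unfolding arc_to_ends_def using inj_onD[OF inj eq(1)] inj_onD[OF inj eq(2)] ends_in by blast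
    then show "d = e" using no_multi_arcs in_G by blast
  qed
  then have "pre_digraph.digraph_isomorphism H F"
    using wfH inj by (auto simp: pre_digraph.digraph_isomorphism_def F_def H_def)
  moreover have "anti_claw = app_iso F H"
  proof -
    have ends: "arcs_ends H = {(x, c), (y, c), (z, c)}"
    proof
      show "arcs_ends H \<subseteq> {(x, c), (y, c), (z, c)}"
      proof
        fix p assume "p \<in> arcs_ends H"
        then obtain u v where p: "p = (u, v)" "u \<rightarrow>\<^bsub>G\<^esub> v" "u \<in> insert c X" "v \<in> insert c X"
          using X by (auto simp: H_def arcs_ends_conv)
        then have "v = c" "u \<in> X"
          using to_c indep not_dominates_self by blast+
        then show "p \<in> {(x, c), (y, c), (z, c)}" using p X by blast
      qed
      show "{(x, c), (y, c), (z, c)} \<subseteq> arcs_ends H"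
        using to_c X by (auto simp: H_def arcs_ends_conv)
    qed
    \<comment> \<open>The image of an arc depends only on its ends, so \<open>arcs_ends H\<close>
      determines the image of \<open>arcs H\<close>.\<close>
    have "iso_arcs F ` arcs H = map_prod \<phi> \<phi> ` arcs_ends H"
      by (auto simp: F_def H_def arcs_ends_conv image_image)
    also have "\<dots> = {(1, 0), (2, 0), (3, 0)}"
      using dist c by (auto simp: ends \<phi>_def)
    finally have "iso_arcs F ` arcs H = {(1, 0), (2, 0), (3, 0)}" .
    moreover have "\<phi> ` {c, x, y, z} = {0, 1, 2, 3}"
      using dist c by (auto simp: \<phi>_def)
    ultimately show ?thesis
      by (simp add: anti_claw_def app_iso_def F_def H_def)
  qed
  ultimately have "digraph_iso H anti_claw"
    unfolding digraph_iso_def by blast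
  then show False
    using free \<open>induced_subgraph H G\<close> by (auto simp: anti_claw_free_def)
qed

end

theorem theorem1:
  fixes D :: "('a, 'b) pre_digraph"
  assumes "digraph D"
    and "sink_free D"
    and "anti_claw_free D"
  shows "\<exists>Q. quasi_kernel D Q \<and> real (card Q) \<le> real (card (verts D)) / 2"
proof -
  interpret digraph D by fact
  have "\<exists>Q. quasi_kernel_on (\<lambda>u v. u \<rightarrow>\<^bsub>D\<^esub> v) (verts D) Q \<and> 2 * card Q \<le> card (verts D)"
  proof (rule small_quasi_kernel_on)
    show "\<exists>w. v \<rightarrow>\<^bsub>D\<^esub> w" if "v \<in> verts D" for v
      using assms(2) that by (auto simp: sink_free_def sink_def)
    show False
      if "card X = 3" "\<And>a. a \<in> X \<Longrightarrow> a \<rightarrow>\<^bsub>D\<^esub> c \<and> \<not> c \<rightarrow>\<^bsub>D\<^esub> a"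
        "\<And>a b. \<lbrakk>a \<in> X; b \<in> X\<rbrakk> \<Longrightarrow> \<not> a \<rightarrow>\<^bsub>D\<^esub> b" for X c
      using anti_claw_freeD[OF assms(3) that] .
  qed (auto simp: not_dominates_self)
  then show ?thesis
    using quasi_kernel_if_on by fastforce
qed

end
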